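(* Let $(P,\cdot,\{~,~\})$ be a Poisson algebra over a field $\mathbf{k}$ of characteristic $0$, let $(V,\mu,\rho)$ be a representation of it, and let $0\to V\xrightarrow{i}E\xrightarrow{p}P\to 0$ be an abelian extension of $P$ by the representation $(V,\mu,\rho)$. Then a pair $(d_V,d_P)\in\mathrm{Der}(V)\times\mathrm{Der}(P)$ of Poisson derivations is inducible if and only if $$(d_V,d_P)\in\mathcal{D}_{\mu,\rho}\quad\text{and}\quad\mathcal{W}(d_V,d_P)=0 .$$
   Context: A Poisson algebra $(P,\cdot,\{~,~\})$ is a commutative associative algebra $(P,\cdot)$ that is also a Lie algebra $(P,\{~,~\})$, with $\{x,y\cdot z\}=\{x,y\}\cdot z+y\cdot\{x,z\}$. A representation $(V,\mu,\rho)$ of it is a vector space $V$ with linear maps $\mu,\rho:P\to\mathrm{End}(V)$ such that for all $x,y\in P$: $\mu_{x\cdot y}=\mu_x\mu_y$, $\rho_{\{x,y\}}=\rho_x\rho_y-\rho_y\rho_x$, $\mu_{\{x,y\}}=\rho_x\mu_y-\mu_y\rho_x$, $\rho_{x\cdot y}=\mu_x\rho_y+\mu_y\rho_x$. An abelian extension of $P$ by $(V,\mu,\rho)$ is a short exact sequence of Poisson algebras $0\to V\xrightarrow{i}E\xrightarrow{p}P\to0$, where $V$ carries the trivial (zero) product and bracket, such that, identifying $V$ with $i(V)\subset E$, one has $\mu_xv=s(x)\cdot_Ev$ and $\rho_xv=\{s(x),v\}_E$ for $x\in P$, $v\in V$ and any linear section $s:P\to E$ of $p$ (i.e. $ps=\mathrm{id}_P$).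 A Poisson derivation of a Poisson algebra is a linear endomorphism that is a derivation for both the product and the bracket; $\mathrm{Der}$ denotes the space of these. Since $V$ has trivial structure, $\mathrm{Der}(V)=\mathrm{End}(V)$. Inducible: $(d_V,d_P)$ is inducible if there is a Poisson derivation $d$ of $E$ with $d(V)\subset V$, $d|_V=d_V$ and $pds=d_P$ (this does not depend on the linear section $s$). $\mathcal{D}_{\mu,\rho}$ is the set of $(d_V,d_P)\in\mathrm{Der}(V)\times\mathrm{Der}(P)$ such that $d_V(\mu_xv)=\mu_{d_P(x)}v+\mu_xd_V(v)$ and $d_V(\rho_xv)=\rho_{d_P(x)}v+\rho_xd_V(v)$ for all $x\in P$, $v\in V$. Second (Flato-Gerstenhaber-Voronov) Poisson cohomology $H^2_{\mathrm{FGV}}(P,V)$: a Poisson $2$-cocycle is a pair $(h,H)$ with $h:P\times P\to V$ symmetric bilinear and $H:P\times P\to V$ skew-symmetric bilinear, satisfying for all $x,y,z\in P$ (1) $\mu_xh(y,z)-h(x\cdot y,z)+h(x,y\cdot z)-\mu_zh(x,y)=0$; (2) $\rho_xH(y,z)+\rho_yH(z,x)+\rho_zH(x,y)+H(x,\{y,z\})+H(y,\{z,x\})+H(z,\{x,y\})=0$; (3) $\rho_xh(y,z)-h(\{x,y\},z)-h(y,\{x,z\})+H(x,y\cdot z)-\mu_yH(x,z)-\mu_zH(x,y)=0$. Two $2$-cocycles $(h,H)$, $(h',H')$ are cohomologous if there is a linear map $\varphi:P\to V$ with $h(x,y)-h'(x,y)=\mu_x\varphi(y)-\varphi(x\cdot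 y)+\mu_y\varphi(x)$ and $H(x,y)-H'(x,y)=\rho_x\varphi(y)-\varphi(\{x,y\})-\rho_y\varphi(x)$. $H^2_{\mathrm{FGV}}(P,V)$ is the vector space of $2$-cocycles modulo this relation. Wells map: choose a linear section $s$ of $p$ and put $h(x,y)=s(x)\cdot_Es(y)-s(x\cdot y)$, $H(x,y)=\{s(x),s(y)\}_E-s(\{x,y\})$; $(h,H)$ is a Poisson $2$-cocycle. For $(d_V,d_P)\in\mathcal{D}_{\mu,\rho}$ set $h_{(d_V,d_P)}(x,y)=d_V(h(x,y))-h(d_P(x),y)-h(x,d_P(y))$ and $H_{(d_V,d_P)}(x,y)=d_V(H(x,y))-H(d_P(x),y)-H(x,d_P(y))$; this is again a $2$-cocycle. Define $\mathcal{W}:\mathcal{D}_{\mu,\rho}\to H^2_{\mathrm{FGV}}(P,V)$ by $\mathcal{W}(d_V,d_P)=[(h_{(d_V,d_P)},H_{(d_V,d_P)})]$; it does not depend on the choice of $s$. *)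

theory Defs
  imports Complex_Main
begin

section \<open>Poisson algebras and their representations\<close>

text \<open>All vector spaces have a whole type as carrier, which is the convention of
  \<^theory>\<open>HOL.Vector_Spaces\<close>; the scalar multiplication is explicit.\<close>

definition bilinear_map ::
  "('k::field \<Rightarrow> 'a::ab_group_add \<Rightarrow> 'a) \<Rightarrow> ('k \<Rightarrow> 'b::ab_group_add \<Rightarrow> 'b) \<Rightarrow> ('k \<Rightarrow> 'c::ab_group_add \<Rightarrow> 'c)
    \<Rightarrow> ('a \<Rightarrow> 'b \<Rightarrow> 'c) \<Rightarrow> bool" where
  "bilinear_map s1 s2 s3 f \<longleftrightarrow>
     (\<forall>x. Vector_Spaces.linear s2 s3 (f x)) \<and> (\<forall>y. Vector_Spaces.linear s1 s3 (\<lambda>x. f x y))"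

record ('k, 'a) poisson =
  pscale :: "'k \<Rightarrow> 'a \<Rightarrow> 'a"
  pprod :: "'a \<Rightarrow> 'a \<Rightarrow> 'a"
  pbrack :: "'a \<Rightarrow> 'a \<Rightarrow> 'a"

locale poisson_algebra = vector_space "pscale A"
  for A :: "('k::field_char_0, 'a::ab_group_add) poisson" +
  assumes prod_bilinear: "bilinear_map (pscale A) (pscale A) (pscale A) (pprod A)"
    and prod_assoc: "pprod A (pprod A x y) z = pprod A x (pprod A y z)"
    and prod_commute: "pprod A x y = pprod A y x"
    and brack_bilinear: "bilinear_map (pscale A) (pscale A) (pscale A) (pbrack A)"
    and brack_alternating: "pbrack A x x = 0"
    and brack_jacobi:
      "pbrack A x (pbrack A y z) + pbrack A y (pbrack A z x) + pbrack A z (pbrack A x y) = 0"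
    and brack_leibniz:
      "pbrack A x (pprod A y z) = pprod A (pbrack A x y) z + pprod A y (pbrack A x z)"

text \<open>Linearity of \<open>\<mu>, \<rho> : P \<rightarrow> End(V)\<close> is expressed as bilinearity of the uncurried action.\<close>

locale poisson_representation = P: poisson_algebra P + V: vector_space vs
  for P :: "('k::field_char_0, 'p::ab_group_add) poisson"
    and vs :: "'k \<Rightarrow> 'v::ab_group_add \<Rightarrow> 'v"
    and \<mu> \<rho> :: "'p \<Rightarrow> 'v \<Rightarrow> 'v" +
  assumes mu_bilinear: "bilinear_map (pscale P) vs vs \<mu>"
    and rho_bilinear: "bilinear_map (pscale P) vs vs \<rho>"
    and mu_prod: "\<mu> (pprod P x y) v = \<mu> x (\<mu> y v)"
    and rho_brack: "\<rho> (pbrack P x y) v = \<rho> x (\<rho> y v) - \<rho> y (\<rho> x v)"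
    and mu_brack: "\<mu> (pbrack P x y) v = \<rho> x (\<mu> y v) - \<mu> y (\<rho> x v)"
    and rho_prod: "\<rho> (pprod P x y) v = \<mu> x (\<rho> y v) + \<mu> y (\<rho> x v)"

definition trivial_poisson :: "('k \<Rightarrow> 'v \<Rightarrow> 'v) \<Rightarrow> ('k, 'v::ab_group_add) poisson" where
  "trivial_poisson vs = \<lparr>pscale = vs, pprod = (\<lambda>_ _. 0), pbrack = (\<lambda>_ _. 0)\<rparr>"

definition poisson_hom ::
  "('k::field, 'a::ab_group_add) poisson \<Rightarrow> ('k, 'b::ab_group_add) poisson \<Rightarrow> ('a \<Rightarrow> 'b) \<Rightarrow> bool" where
  "poisson_hom A B f \<longleftrightarrow> Vector_Spaces.linear (pscale A) (pscale B) f \<and>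
     (\<forall>x y. f (pprod A x y) = pprod B (f x) (f y)) \<and>
     (\<forall>x y. f (pbrack A x y) = pbrack B (f x) (f y))"

definition poisson_Der :: "('k::field, 'a::ab_group_add) poisson \<Rightarrow> ('a \<Rightarrow> 'a) set" where
  "poisson_Der A = {d. Vector_Spaces.linear (pscale A) (pscale A) d \<and>
     (\<forall>x y. d (pprod A x y) = pprod A (d x) y + pprod A x (d y)) \<and>
     (\<forall>x y. d (pbrack A x y) = pbrack A (d x) y + pbrack A x (d y))}"


section \<open>Second Flato-Gerstenhaber-Voronov cohomology\<close>

definition poisson_cocycles ::
  "('k::field, 'p::ab_group_add) poisson \<Rightarrow> ('k \<Rightarrow> 'v::ab_group_add \<Rightarrow> 'v) \<Rightarrow> ('p \<Rightarrow> 'v \<Rightarrow> 'v) \<Rightarrow> ('p \<Rightarrow> 'v \<Rightarrow> 'v)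
    \<Rightarrow> (('p \<Rightarrow> 'p \<Rightarrow> 'v) \<times> ('p \<Rightarrow> 'p \<Rightarrow> 'v)) set" where
  "poisson_cocycles P vs \<mu> \<rho> = {(h, H).
     bilinear_map (pscale P) (pscale P) vs h \<and> (\<forall>x y. h x y = h y x) \<and>
     bilinear_map (pscale P) (pscale P) vs H \<and> (\<forall>x y. H x y = - H y x) \<and>
     (\<forall>x y z. \<mu> x (h y z) - h (pprod P x y) z + h x (pprod P y z) - \<mu> z (h x y) = 0) \<and>
     (\<forall>x y z. \<rho> x (H y z) + \<rho> y (H z x) + \<rho> z (H x y)
        + H x (pbrack P y z) + H y (pbrack P z x) + H z (pbrack P x y) = 0) \<and>
     (\<forall>x y z. \<rho> x (h y z) - h (pbrack P x y) z - h y (pbrack P x z)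
        + H x (pprod P y z) - \<mu> y (H x z) - \<mu> z (H x y) = 0)}"

definition poisson_cohomologous ::
  "('k::field, 'p::ab_group_add) poisson \<Rightarrow> ('k \<Rightarrow> 'v::ab_group_add \<Rightarrow> 'v) \<Rightarrow> ('p \<Rightarrow> 'v \<Rightarrow> 'v) \<Rightarrow> ('p \<Rightarrow> 'v \<Rightarrow> 'v)
    \<Rightarrow> (('p \<Rightarrow> 'p \<Rightarrow> 'v) \<times> ('p \<Rightarrow> 'p \<Rightarrow> 'v)) rel" where
  "poisson_cohomologous P vs \<mu> \<rho> = {((h, H), (h', H')).
     (h, H) \<in> poisson_cocycles P vs \<mu> \<rho> \<and> (h', H') \<in> poisson_cocycles P vs \<mu> \<rho> \<and>
     (\<exists>\<phi>. Vector_Spaces.linear (pscale P) vs \<phi> \<and>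
        (\<forall>x y. h x y - h' x y = \<mu> x (\<phi> y) - \<phi> (pprod P x y) + \<mu> y (\<phi> x)) \<and>
        (\<forall>x y. H x y - H' x y = \<rho> x (\<phi> y) - \<phi> (pbrack P x y) - \<rho> y (\<phi> x)))}"

definition H2_FGV ::
  "('k::field, 'p::ab_group_add) poisson \<Rightarrow> ('k \<Rightarrow> 'v::ab_group_add \<Rightarrow> 'v) \<Rightarrow> ('p \<Rightarrow> 'v \<Rightarrow> 'v) \<Rightarrow> ('p \<Rightarrow> 'v \<Rightarrow> 'v)
    \<Rightarrow> (('p \<Rightarrow> 'p \<Rightarrow> 'v) \<times> ('p \<Rightarrow> 'p \<Rightarrow> 'v)) set set" where
  "H2_FGV P vs \<mu> \<rho> = poisson_cocycles P vs \<mu> \<rho> // poisson_cohomologous P vs \<mu> \<rho>"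

definition H2_class ::
  "('k::field, 'p::ab_group_add) poisson \<Rightarrow> ('k \<Rightarrow> 'v::ab_group_add \<Rightarrow> 'v) \<Rightarrow> ('p \<Rightarrow> 'v \<Rightarrow> 'v) \<Rightarrow> ('p \<Rightarrow> 'v \<Rightarrow> 'v)
    \<Rightarrow> ('p \<Rightarrow> 'p \<Rightarrow> 'v) \<times> ('p \<Rightarrow> 'p \<Rightarrow> 'v) \<Rightarrow> (('p \<Rightarrow> 'p \<Rightarrow> 'v) \<times> ('p \<Rightarrow> 'p \<Rightarrow> 'v)) set" where
  "H2_class P vs \<mu> \<rho> c = poisson_cohomologous P vs \<mu> \<rho> `` {c}"

definition H2_zero ::
  "('k::field, 'p::ab_group_add) poisson \<Rightarrow> ('k \<Rightarrow> 'v::ab_group_add \<Rightarrow> 'v) \<Rightarrow> ('p \<Rightarrow> 'v \<Rightarrow> 'v) \<Rightarrow> ('p \<Rightarrow> 'v \<Rightarrow> 'v)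
    \<Rightarrow> (('p \<Rightarrow> 'p \<Rightarrow> 'v) \<times> ('p \<Rightarrow> 'p \<Rightarrow> 'v)) set" where
  "H2_zero P vs \<mu> \<rho> = H2_class P vs \<mu> \<rho> ((\<lambda>_ _. 0), (\<lambda>_ _. 0))"


section \<open>Abelian extensions, inducible pairs and the Wells map\<close>

definition linear_section ::
  "('k::field, 'p::ab_group_add) poisson \<Rightarrow> ('k, 'e::ab_group_add) poisson \<Rightarrow> ('e \<Rightarrow> 'p) \<Rightarrow> ('p \<Rightarrow> 'e) \<Rightarrow> bool" where
  "linear_section P E p s \<longleftrightarrow> Vector_Spaces.linear (pscale P) (pscale E) s \<and> p \<circ> s = id"

locale abelian_extension = poisson_representation P vs \<mu> \<rho> + E: poisson_algebra E
  for P :: "('k::field_char_0, 'p::ab_group_add) poisson"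
    and vs :: "'k \<Rightarrow> 'v::ab_group_add \<Rightarrow> 'v"
    and \<mu> \<rho> :: "'p \<Rightarrow> 'v \<Rightarrow> 'v"
    and E :: "('k, 'e::ab_group_add) poisson"
    and i :: "'v \<Rightarrow> 'e" and p :: "'e \<Rightarrow> 'p" +
  assumes i_hom: "poisson_hom (trivial_poisson vs) E i"
    and p_hom: "poisson_hom E P p"
    and i_inj: "inj i"
    and exact: "range i = {e. p e = 0}"
    and p_surj: "surj p"
    and mu_induced: "linear_section P E p s \<Longrightarrow> i (\<mu> x v) = pprod E (s x) (i v)"
    and rho_induced: "linear_section P E p s \<Longrightarrow> i (\<rho> x v) = pbrack E (s x) (i v)"

text \<open>Sections exist (lemma \<open>ex_linear_section\<close> below), and the condition on them does not depend
  on the section, so the universal quantifier agrees with fixing any one section.\<close>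

definition inducible ::
  "('k::field, 'p::ab_group_add) poisson \<Rightarrow> ('k, 'e::ab_group_add) poisson \<Rightarrow> ('v \<Rightarrow> 'e) \<Rightarrow> ('e \<Rightarrow> 'p)
    \<Rightarrow> ('v \<Rightarrow> 'v) \<times> ('p \<Rightarrow> 'p) \<Rightarrow> bool" where
  "inducible P E i p = (\<lambda>(dV, dP). \<exists>d \<in> poisson_Der E.
     d ` range i \<subseteq> range i \<and> (\<forall>v. d (i v) = i (dV v)) \<and>
     (\<forall>s. linear_section P E p s \<longrightarrow> p \<circ> d \<circ> s = dP))"

definition compatible_pairs ::
  "('k::field, 'p::ab_group_add) poisson \<Rightarrow> ('k \<Rightarrow> 'v::ab_group_add \<Rightarrow> 'v) \<Rightarrow> ('p \<Rightarrow> 'v \<Rightarrow> 'v) \<Rightarrow> ('p \<Rightarrow> 'v \<Rightarrow> 'v)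
    \<Rightarrow> (('v \<Rightarrow> 'v) \<times> ('p \<Rightarrow> 'p)) set" where
  "compatible_pairs P vs \<mu> \<rho> = {(dV, dP).
     dV \<in> poisson_Der (trivial_poisson vs) \<and> dP \<in> poisson_Der P \<and>
     (\<forall>x v. dV (\<mu> x v) = \<mu> (dP x) v + \<mu> x (dV v)) \<and>
     (\<forall>x v. dV (\<rho> x v) = \<rho> (dP x) v + \<rho> x (dV v))}"

definition section_cocycle ::
  "('k, 'p) poisson \<Rightarrow> ('k, 'e::ab_group_add) poisson \<Rightarrow> ('v \<Rightarrow> 'e) \<Rightarrow> ('p \<Rightarrow> 'e)
    \<Rightarrow> ('p \<Rightarrow> 'p \<Rightarrow> 'v) \<times> ('p \<Rightarrow> 'p \<Rightarrow> 'v)" where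
  "section_cocycle P E i s =
     ((\<lambda>x y. inv i (pprod E (s x) (s y) - s (pprod P x y))),
      (\<lambda>x y. inv i (pbrack E (s x) (s y) - s (pbrack P x y))))"

definition derived_cocycle ::
  "('v::ab_group_add \<Rightarrow> 'v) \<times> ('p \<Rightarrow> 'p) \<Rightarrow> ('p \<Rightarrow> 'p \<Rightarrow> 'v) \<times> ('p \<Rightarrow> 'p \<Rightarrow> 'v)
    \<Rightarrow> ('p \<Rightarrow> 'p \<Rightarrow> 'v) \<times> ('p \<Rightarrow> 'p \<Rightarrow> 'v)" where
  "derived_cocycle = (\<lambda>(dV, dP) (h, H).
     ((\<lambda>x y. dV (h x y) - h (dP x) y - h x (dP y)),
      (\<lambda>x y. dV (H x y) - H (dP x) y - H x (dP y))))"

text \<open>The choice of section is immaterial on \<open>compatible_pairs\<close>, the domain of the Wells map: see \<open>wells_map_eq\<close> below.\<close>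

definition wells_map ::
  "('k::field, 'p::ab_group_add) poisson \<Rightarrow> ('k \<Rightarrow> 'v::ab_group_add \<Rightarrow> 'v) \<Rightarrow> ('p \<Rightarrow> 'v \<Rightarrow> 'v) \<Rightarrow> ('p \<Rightarrow> 'v \<Rightarrow> 'v)
    \<Rightarrow> ('k, 'e::ab_group_add) poisson \<Rightarrow> ('v \<Rightarrow> 'e) \<Rightarrow> ('e \<Rightarrow> 'p)
    \<Rightarrow> ('v \<Rightarrow> 'v) \<times> ('p \<Rightarrow> 'p) \<Rightarrow> (('p \<Rightarrow> 'p \<Rightarrow> 'v) \<times> ('p \<Rightarrow> 'p \<Rightarrow> 'v)) set" where
  "wells_map P vs \<mu> \<rho> E i p D = H2_class P vs \<mu> \<rho>
     (derived_cocycle D (section_cocycle P E i (SOME s. linear_section P E p s)))"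


section \<open>Well-definedness of the cohomology and of the Wells map\<close>

lemma linear_facts:
  assumes "Vector_Spaces.linear s1 s2 f"
  shows "f (x + y) = f x + f y" "f (x - y) = f x - f y" "f (- x) = - f x" "f 0 = 0"
    "f (s1 c x) = s2 c (f x)"
proof -
  interpret Vector_Spaces.linear s1 s2 f by fact
  show "f (x + y) = f x + f y" "f (x - y) = f x - f y" "f (- x) = - f x" "f 0 = 0"
    "f (s1 c x) = s2 c (f x)"
    by (rule add diff neg zero scale)+
qed

lemma bilinear_facts:
  assumes "bilinear_map s1 s2 s3 f"
  shows "f (x + x') y = f x y + f x' y" "f (x - x') y = f x y - f x' y" "f (- x) y = - f x y"
    "f 0 y = 0" "f (s1 c x) y = s3 c (f x y)"
    "f x (y + y') = f x y + f x y'" "f x (y - y') = f x y - f x y'" "f x (- y) = - f x y"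
    "f x 0 = 0" "f x (s2 c y) = s3 c (f x y)"
proof -
  have 1: "Vector_Spaces.linear s2 s3 (f x)" for x
    using assms by (simp add: bilinear_map_def)
  have 2: "Vector_Spaces.linear s1 s3 (\<lambda>x. f x y)" for y
    using assms by (simp add: bilinear_map_def)
  show "f (x + x') y = f x y + f x' y" "f (x - x') y = f x y - f x' y" "f (- x) y = - f x y"
    "f 0 y = 0" "f (s1 c x) y = s3 c (f x y)"
    by (rule linear_facts[OF 2])+
  show "f x (y + y') = f x y + f x y'" "f x (y - y') = f x y - f x y'" "f x (- y) = - f x y"
    "f x 0 = 0" "f x (s2 c y) = s3 c (f x y)"
    by (rule linear_facts[OF 1])+
qed

lemma linearI:
  assumes "vector_space s1" "vector_space s2"
    "\<And>x y. f (x + y) = f x + f y" "\<And>c x. f (s1 c x) = s2 c (f x)"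
  shows "Vector_Spaces.linear s1 s2 f"
  using assms unfolding Vector_Spaces.linear_iff by blast

lemma (in poisson_algebra) brack_skew: "pbrack A x y = - pbrack A y x"
proof -
  have "pbrack A (x + y) (x + y) = 0" by (rule brack_alternating)
  then have "pbrack A x y + pbrack A y x = 0"
    by (simp add: bilinear_facts[OF brack_bilinear] brack_alternating[of x] brack_alternating[of y] add.commute)
  then show ?thesis by (rule eq_neg_iff_add_eq_0[THEN iffD2])
qed

context poisson_representation
begin

lemmas rep_simps =
  bilinear_facts[OF P.prod_bilinear] bilinear_facts[OF P.brack_bilinear]
  bilinear_facts[OF mu_bilinear] bilinear_facts[OF rho_bilinear]

lemma zero_cocycle: "((\<lambda>_ _. 0), (\<lambda>_ _. 0)) \<in> poisson_cocycles P vs \<mu> \<rho>"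
proof -
  have "Vector_Spaces.linear (pscale P) vs (\<lambda>_. 0)"
    by (rule linearI) (simp_all add: P.vector_space_axioms V.vector_space_axioms)
  then show ?thesis
    by (simp add: poisson_cocycles_def bilinear_map_def rep_simps)
qed

lemma equiv_cohomologous:
  "equiv (poisson_cocycles P vs \<mu> \<rho>) (poisson_cohomologous P vs \<mu> \<rho>)"
proof (rule equivI)
  show "poisson_cohomologous P vs \<mu> \<rho> \<subseteq> poisson_cocycles P vs \<mu> \<rho> \<times> poisson_cocycles P vs \<mu> \<rho>"
    by (auto simp: poisson_cohomologous_def)
  have lin0: "Vector_Spaces.linear (pscale P) vs (\<lambda>_. 0)"
    by (rule linearI) (simp_all add: P.vector_space_axioms V.vector_space_axioms)
  show "refl_on (poisson_cocycles P vs \<mu> \<rho>) (poisson_cohomologous P vs \<mu> \<rho>)"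
    by (rule refl_onI)
      (auto simp: poisson_cohomologous_def rep_simps intro!: exI[of _ "\<lambda>_. 0"] lin0)
  show "sym (poisson_cohomologous P vs \<mu> \<rho>)"
  proof (rule symI, clarsimp simp: poisson_cohomologous_def)
    fix h H h' H' \<phi>
    assume lin: "Vector_Spaces.linear (pscale P) vs \<phi>"
      and h: "\<forall>x y. h x y - h' x y = \<mu> x (\<phi> y) - \<phi> (pprod P x y) + \<mu> y (\<phi> x)"
      and H: "\<forall>x y. H x y - H' x y = \<rho> x (\<phi> y) - \<phi> (pbrack P x y) - \<rho> y (\<phi> x)"
    have "Vector_Spaces.linear (pscale P) vs (\<lambda>x. - \<phi> x)"
      by (rule linearI) (simp_all add: P.vector_space_axioms V.vector_space_axioms linear_facts[OF lin])
    moreover have "h' x y - h x y = \<mu> x (- \<phi> y) - - \<phi> (pprod P x y) + \<mu> y (- \<phi> x)" for x y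
      using h[rule_format, of x y] by (simp add: rep_simps algebra_simps)
    moreover have "H' x y - H x y = \<rho> x (- \<phi> y) - - \<phi> (pbrack P x y) - \<rho> y (- \<phi> x)" for x y
      using H[rule_format, of x y] by (simp add: rep_simps algebra_simps)
    ultimately show "\<exists>\<phi>. Vector_Spaces.linear (pscale P) vs \<phi> \<and>
        (\<forall>x y. h' x y - h x y = \<mu> x (\<phi> y) - \<phi> (pprod P x y) + \<mu> y (\<phi> x)) \<and>
        (\<forall>x y. H' x y - H x y = \<rho> x (\<phi> y) - \<phi> (pbrack P x y) - \<rho> y (\<phi> x))"
      by (intro exI[of _ "\<lambda>x. - \<phi> x"]) blast
  qed
  show "trans (poisson_cohomologous P vs \<mu> \<rho>)"
  proof (rule transI, clarsimp simp: poisson_cohomologous_def)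
    fix h H h' H' h'' H'' \<phi> \<psi>
    assume lin: "Vector_Spaces.linear (pscale P) vs \<phi>" "Vector_Spaces.linear (pscale P) vs \<psi>"
      and h: "\<forall>x y. h x y - h' x y = \<mu> x (\<phi> y) - \<phi> (pprod P x y) + \<mu> y (\<phi> x)"
      and H: "\<forall>x y. H x y - H' x y = \<rho> x (\<phi> y) - \<phi> (pbrack P x y) - \<rho> y (\<phi> x)"
      and h': "\<forall>x y. h' x y - h'' x y = \<mu> x (\<psi> y) - \<psi> (pprod P x y) + \<mu> y (\<psi> x)"
      and H': "\<forall>x y. H' x y - H'' x y = \<rho> x (\<psi> y) - \<psi> (pbrack P x y) - \<rho> y (\<psi> x)"
    let ?\<theta> = "\<lambda>x. \<phi> x + \<psi> x"
    have "Vector_Spaces.linear (pscale P) vs ?\<theta>"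
      by (rule linearI) (simp_all add: P.vector_space_axioms V.vector_space_axioms
          linear_facts[OF lin(1)] linear_facts[OF lin(2)] V.scale_right_distrib)
    moreover have "h x y - h'' x y = \<mu> x (?\<theta> y) - ?\<theta> (pprod P x y) + \<mu> y (?\<theta> x)" for x y
    proof -
      have "h x y - h'' x y = (h x y - h' x y) + (h' x y - h'' x y)" by simp
      then show ?thesis by (simp only: h h') (simp add: rep_simps)
    qed
    moreover have "H x y - H'' x y = \<rho> x (?\<theta> y) - ?\<theta> (pbrack P x y) - \<rho> y (?\<theta> x)" for x y
    proof -
      have "H x y - H'' x y = (H x y - H' x y) + (H' x y - H'' x y)" by simp
      then show ?thesis by (simp only: H H') (simp add: rep_simps)
    qed
    ultimately show "\<exists>\<phi>. Vector_Spaces.linear (pscale P) vs \<phi> \<and>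
        (\<forall>x y. h x y - h'' x y = \<mu> x (\<phi> y) - \<phi> (pprod P x y) + \<mu> y (\<phi> x)) \<and>
        (\<forall>x y. H x y - H'' x y = \<rho> x (\<phi> y) - \<phi> (pbrack P x y) - \<rho> y (\<phi> x))"
      by blast
  qed
qed

lemma H2_zero_in: "H2_zero P vs \<mu> \<rho> \<in> H2_FGV P vs \<mu> \<rho>"
  unfolding H2_zero_def H2_class_def H2_FGV_def by (rule quotientI[OF zero_cocycle])

end

lemma (in vector_space) bilinear_mapI:
  assumes "vector_space s1" "vector_space s2"
    "\<And>x x' y. f (x + x') y = f x y + f x' y" "\<And>c x y. f (s1 c x) y = scale c (f x y)"
    "\<And>x y y'. f x (y + y') = f x y + f x y'" "\<And>c x y. f x (s2 c y) = scale c (f x y)"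
  shows "bilinear_map s1 s2 scale f"
  unfolding bilinear_map_def using assms vector_space_axioms by (intro conjI allI linearI)

lemma (in poisson_representation) derived_cocycle_in:
  assumes c: "c \<in> poisson_cocycles P vs \<mu> \<rho>" and D: "D \<in> compatible_pairs P vs \<mu> \<rho>"
  shows "derived_cocycle D c \<in> poisson_cocycles P vs \<mu> \<rho>"
proof -
  obtain h H where ceq: "c = (h, H)" by fastforce
  obtain dV dP where Deq: "D = (dV, dP)" by fastforce
  from D Deq have dV: "Vector_Spaces.linear vs vs dV"
    and dP: "Vector_Spaces.linear (pscale P) (pscale P) dP"
      "\<And>x y. dP (pprod P x y) = pprod P (dP x) y + pprod P x (dP y)"
      "\<And>x y. dP (pbrack P x y) = pbrack P (dP x) y + pbrack P x (dP y)"
    and comp: "\<And>x v. dV (\<mu> x v) = \<mu> (dP x) v + \<mu> x (dV v)"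
      "\<And>x v. dV (\<rho> x v) = \<rho> (dP x) v + \<rho> x (dV v)"
    by (auto simp: compatible_pairs_def poisson_Der_def trivial_poisson_def)
  from c ceq have h: "bilinear_map (pscale P) (pscale P) vs h" "\<And>x y. h x y = h y x"
    and H: "bilinear_map (pscale P) (pscale P) vs H" "\<And>x y. H x y = - H y x"
    and c1: "\<And>x y z. \<mu> x (h y z) - h (pprod P x y) z + h x (pprod P y z) - \<mu> z (h x y) = 0"
    and c2: "\<And>x y z. \<rho> x (H y z) + \<rho> y (H z x) + \<rho> z (H x y)
        + H x (pbrack P y z) + H y (pbrack P z x) + H z (pbrack P x y) = 0"
    and c3: "\<And>x y z. \<rho> x (h y z) - h (pbrack P x y) z - h y (pbrack P x z)
        + H x (pprod P y z) - \<mu> y (H x z) - \<mu> z (H x y) = 0"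
    unfolding poisson_cocycles_def by blast+
  note S = linear_facts[OF dV] linear_facts[OF dP(1)] bilinear_facts[OF h(1)] bilinear_facts[OF H(1)]
    rep_simps dP(2,3) comp
  let ?h = "\<lambda>x y. dV (h x y) - h (dP x) y - h x (dP y)"
  let ?H = "\<lambda>x y. dV (H x y) - H (dP x) y - H x (dP y)"
  have b: "bilinear_map (pscale P) (pscale P) vs ?h" "bilinear_map (pscale P) (pscale P) vs ?H"
    by (rule V.bilinear_mapI;
        simp add: P.vector_space_axioms S V.scale_right_diff_distrib)+
  have sh: "?h x y = ?h y x" for x y
    using h(2)[of x y] h(2)[of "dP x" y] h(2)[of x "dP y"] by simp
  have sH: "?H x y = - ?H y x" for x y
    using H(2)[of x y] H(2)[of "dP x" y] H(2)[of x "dP y"] by (simp add: S)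
  let ?c1 = "\<lambda>x y z. \<mu> x (h y z) - h (pprod P x y) z + h x (pprod P y z) - \<mu> z (h x y)"
  let ?c2 = "\<lambda>x y z. \<rho> x (H y z) + \<rho> y (H z x) + \<rho> z (H x y)
        + H x (pbrack P y z) + H y (pbrack P z x) + H z (pbrack P x y)"
  let ?c3 = "\<lambda>x y z. \<rho> x (h y z) - h (pbrack P x y) z - h y (pbrack P x z)
        + H x (pprod P y z) - \<mu> y (H x z) - \<mu> z (H x y)"
  have d1: "\<mu> x (?h y z) - ?h (pprod P x y) z + ?h x (pprod P y z) - \<mu> z (?h x y) = 0" for x y z
  proof -
    have "\<mu> x (?h y z) - ?h (pprod P x y) z + ?h x (pprod P y z) - \<mu> z (?h x y)
      = dV (?c1 x y z) - ?c1 (dP x) y z - ?c1 x (dP y) z - ?c1 x y (dP z)"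
      by (simp add: S algebra_simps)
    then show ?thesis by (simp only: c1) (simp add: S)
  qed
  have d2: "\<rho> x (?H y z) + \<rho> y (?H z x) + \<rho> z (?H x y)
        + ?H x (pbrack P y z) + ?H y (pbrack P z x) + ?H z (pbrack P x y) = 0" for x y z
  proof -
    have "\<rho> x (?H y z) + \<rho> y (?H z x) + \<rho> z (?H x y)
        + ?H x (pbrack P y z) + ?H y (pbrack P z x) + ?H z (pbrack P x y)
      = dV (?c2 x y z) - ?c2 (dP x) y z - ?c2 x (dP y) z - ?c2 x y (dP z)"
      by (simp add: S algebra_simps)
    then show ?thesis by (simp only: c2) (simp add: S)
  qed
  have d3: "\<rho> x (?h y z) - ?h (pbrack P x y) z - ?h y (pbrack P x z)
        + ?H x (pprod P y z) - \<mu> y (?H x z) - \<mu> z (?H x y) = 0" for x y z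
  proof -
    have "\<rho> x (?h y z) - ?h (pbrack P x y) z - ?h y (pbrack P x z)
        + ?H x (pprod P y z) - \<mu> y (?H x z) - \<mu> z (?H x y)
      = dV (?c3 x y z) - ?c3 (dP x) y z - ?c3 x (dP y) z - ?c3 x y (dP z)"
      by (simp add: S algebra_simps)
    then show ?thesis by (simp only: c3) (simp add: S)
  qed
  show ?thesis
    unfolding ceq Deq derived_cocycle_def poisson_cocycles_def prod.case mem_Collect_eq
    by (intro conjI allI b sh sH d1 d2 d3)
qed

lemma (in poisson_representation) derived_cocycle_cong:
  assumes c: "(c, c') \<in> poisson_cohomologous P vs \<mu> \<rho>" and D: "D \<in> compatible_pairs P vs \<mu> \<rho>"
  shows "(derived_cocycle D c, derived_cocycle D c') \<in> poisson_cohomologous P vs \<mu> \<rho>"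
proof -
  obtain h H h' H' where ceq: "c = (h, H)" "c' = (h', H')" by fastforce
  obtain dV dP where Deq: "D = (dV, dP)" by fastforce
  from D Deq have dV: "Vector_Spaces.linear vs vs dV"
    and dP: "Vector_Spaces.linear (pscale P) (pscale P) dP"
      "\<And>x y. dP (pprod P x y) = pprod P (dP x) y + pprod P x (dP y)"
      "\<And>x y. dP (pbrack P x y) = pbrack P (dP x) y + pbrack P x (dP y)"
    and comp: "\<And>x v. dV (\<mu> x v) = \<mu> (dP x) v + \<mu> x (dV v)"
      "\<And>x v. dV (\<rho> x v) = \<rho> (dP x) v + \<rho> x (dV v)"
    by (auto simp: compatible_pairs_def poisson_Der_def trivial_poisson_def)
  from c ceq obtain \<phi> where cc: "c \<in> poisson_cocycles P vs \<mu> \<rho>" "c' \<in> poisson_cocycles P vs \<mu> \<rho>"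
    and lin: "Vector_Spaces.linear (pscale P) vs \<phi>"
    and h: "\<And>x y. h x y - h' x y = \<mu> x (\<phi> y) - \<phi> (pprod P x y) + \<mu> y (\<phi> x)"
    and H: "\<And>x y. H x y - H' x y = \<rho> x (\<phi> y) - \<phi> (pbrack P x y) - \<rho> y (\<phi> x)"
    by (auto simp: poisson_cohomologous_def)
  note S = linear_facts[OF dV] linear_facts[OF dP(1)] linear_facts[OF lin] rep_simps dP(2,3) comp
  let ?\<psi> = "\<lambda>x. dV (\<phi> x) - \<phi> (dP x)"
  have "Vector_Spaces.linear (pscale P) vs ?\<psi>"
    by (rule linearI) (simp_all add: P.vector_space_axioms V.vector_space_axioms S
        V.scale_right_diff_distrib)
  moreover have "(dV (h x y) - h (dP x) y - h x (dP y)) - (dV (h' x y) - h' (dP x) y - h' x (dP y))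
      = \<mu> x (?\<psi> y) - ?\<psi> (pprod P x y) + \<mu> y (?\<psi> x)" for x y
  proof -
    have "(dV (h x y) - h (dP x) y - h x (dP y)) - (dV (h' x y) - h' (dP x) y - h' x (dP y))
      = dV (h x y - h' x y) - (h (dP x) y - h' (dP x) y) - (h x (dP y) - h' x (dP y))"
      by (simp add: S)
    then show ?thesis by (simp only: h) (simp add: S algebra_simps)
  qed
  moreover have "(dV (H x y) - H (dP x) y - H x (dP y)) - (dV (H' x y) - H' (dP x) y - H' x (dP y))
      = \<rho> x (?\<psi> y) - ?\<psi> (pbrack P x y) - \<rho> y (?\<psi> x)" for x y
  proof -
    have "(dV (H x y) - H (dP x) y - H x (dP y)) - (dV (H' x y) - H' (dP x) y - H' x (dP y))
      = dV (H x y - H' x y) - (H (dP x) y - H' (dP x) y) - (H x (dP y) - H' x (dP y))"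
      by (simp add: S)
    then show ?thesis by (simp only: H) (simp add: S algebra_simps)
  qed
  moreover note derived_cocycle_in[OF cc(1) D] derived_cocycle_in[OF cc(2) D]
  ultimately show ?thesis
    unfolding ceq Deq derived_cocycle_def poisson_cohomologous_def prod.case mem_Collect_eq by blast
qed

context abelian_extension
begin

lemma ex_linear_section: "\<exists>s. linear_section P E p s"
proof -
  interpret EP: vector_space_pair "pscale E" "pscale P" ..
  from EP.linear_surjective_right_inverse[OF _ p_surj] p_hom show ?thesis
    by (simp add: linear_section_def poisson_hom_def)
qed

lemma i_linear: "Vector_Spaces.linear vs (pscale E) i"
  using i_hom by (simp add: poisson_hom_def trivial_poisson_def)

lemma p_linear: "Vector_Spaces.linear (pscale E) (pscale P) p"
  using p_hom by (simp add: poisson_hom_def)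

lemma i_inv: "p e = 0 \<Longrightarrow> i (inv i e) = e"
  using exact by (intro f_inv_into_f) blast

lemma i_section_cocycle:
  assumes s: "linear_section P E p s"
  shows "i (fst (section_cocycle P E i s) x y) = pprod E (s x) (s y) - s (pprod P x y)"
    and "i (snd (section_cocycle P E i s) x y) = pbrack E (s x) (s y) - s (pbrack P x y)"
proof -
  have ps: "p (s x) = x" for x
    using s by (simp add: linear_section_def fun_eq_iff)
  show "i (fst (section_cocycle P E i s) x y) = pprod E (s x) (s y) - s (pprod P x y)"
    "i (snd (section_cocycle P E i s) x y) = pbrack E (s x) (s y) - s (pbrack P x y)"
    using p_hom
    by (simp_all add: section_cocycle_def i_inv linear_facts[OF p_linear] poisson_hom_def ps)
qed

lemma section_cocycle_in:
  assumes s: "linear_section P E p s"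
  shows "section_cocycle P E i s \<in> poisson_cocycles P vs \<mu> \<rho>"
proof -
  obtain h H where ceq: "section_cocycle P E i s = (h, H)" by fastforce
  note iC = i_section_cocycle[OF s, unfolded ceq fst_conv snd_conv]
  have sl: "Vector_Spaces.linear (pscale P) (pscale E) s"
    using s by (simp add: linear_section_def)
  note S = linear_facts[OF i_linear] linear_facts[OF sl] iC rep_simps
    bilinear_facts[OF E.prod_bilinear] bilinear_facts[OF E.brack_bilinear]
    mu_induced[OF s] rho_induced[OF s]
  have b: "bilinear_map (pscale P) (pscale P) vs h" "bilinear_map (pscale P) (pscale P) vs H"
    by (rule V.bilinear_mapI; (rule injD[OF i_inj])?;
        simp add: P.vector_space_axioms S E.scale_right_diff_distrib)+
  have sh: "h x y = h y x" for x y
    by (rule injD[OF i_inj]) (simp add: S E.prod_commute[of "s x"] P.prod_commute[of x])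
  have sH: "H x y = - H y x" for x y
    using E.brack_skew[of "s x" "s y"] P.brack_skew[of x y]
    by (intro injD[OF i_inj]) (simp add: S)
  have d1: "\<mu> x (h y z) - h (pprod P x y) z + h x (pprod P y z) - \<mu> z (h x y) = 0" for x y z
    using E.prod_assoc[of "s x" "s y" "s z"] E.prod_commute[of "s z" "s (pprod P x y)"]
      E.prod_commute[of "s z" "pprod E (s x) (s y)"]
    by (intro injD[OF i_inj]) (simp add: S P.prod_assoc)
  have d2: "\<rho> x (H y z) + \<rho> y (H z x) + \<rho> z (H x y)
        + H x (pbrack P y z) + H y (pbrack P z x) + H z (pbrack P x y) = 0" for x y z
  proof (rule injD[OF i_inj])
    have "i (\<rho> x (H y z) + \<rho> y (H z x) + \<rho> z (H x y)
        + H x (pbrack P y z) + H y (pbrack P z x) + H z (pbrack P x y))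
      = (pbrack E (s x) (pbrack E (s y) (s z)) + pbrack E (s y) (pbrack E (s z) (s x))
           + pbrack E (s z) (pbrack E (s x) (s y)))
        - s (pbrack P x (pbrack P y z) + pbrack P y (pbrack P z x) + pbrack P z (pbrack P x y))"
      by (simp add: S)
    then show "i (\<rho> x (H y z) + \<rho> y (H z x) + \<rho> z (H x y)
        + H x (pbrack P y z) + H y (pbrack P z x) + H z (pbrack P x y)) = i 0"
      by (simp only: P.brack_jacobi E.brack_jacobi) (simp add: S)
  qed
  have d3: "\<rho> x (h y z) - h (pbrack P x y) z - h y (pbrack P x z)
        + H x (pprod P y z) - \<mu> y (H x z) - \<mu> z (H x y) = 0" for x y z
    by (rule injD[OF i_inj])
      (simp add: S P.brack_leibniz E.brack_leibniz E.prod_commute[of "s z"])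
  show ?thesis
    unfolding ceq poisson_cocycles_def prod.case mem_Collect_eq
    by (intro conjI allI b sh sH d1 d2 d3)
qed

lemma section_cocycle_cohomologous:
  assumes s: "linear_section P E p s" and t: "linear_section P E p t"
  shows "(section_cocycle P E i s, section_cocycle P E i t) \<in> poisson_cohomologous P vs \<mu> \<rho>"
proof -
  obtain h H where ceq: "section_cocycle P E i s = (h, H)" by fastforce
  obtain h' H' where ceq': "section_cocycle P E i t = (h', H')" by fastforce
  note iC = i_section_cocycle[OF s, unfolded ceq fst_conv snd_conv]
    i_section_cocycle[OF t, unfolded ceq' fst_conv snd_conv]
  have sl: "Vector_Spaces.linear (pscale P) (pscale E) s"
    and tl: "Vector_Spaces.linear (pscale P) (pscale E) t"
    using s t by (simp_all add: linear_section_def)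
  have ps: "p (s x) = x" "p (t x) = x" for x
    using s t by (simp_all add: linear_section_def fun_eq_iff)
  define \<phi> where "\<phi> x = inv i (s x - t x)" for x
  have i\<phi>: "i (\<phi> x) = s x - t x" for x
    unfolding \<phi>_def by (rule i_inv) (simp add: linear_facts[OF p_linear] ps)
  note S = linear_facts[OF i_linear] linear_facts[OF sl] linear_facts[OF tl] iC i\<phi> rep_simps
    bilinear_facts[OF E.prod_bilinear] bilinear_facts[OF E.brack_bilinear]
  have "Vector_Spaces.linear (pscale P) vs \<phi>"
    by (rule linearI; (rule injD[OF i_inj])?;
        simp add: P.vector_space_axioms V.vector_space_axioms S E.scale_right_diff_distrib)
  moreover have "h x y - h' x y = \<mu> x (\<phi> y) - \<phi> (pprod P x y) + \<mu> y (\<phi> x)" for x y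
    by (rule injD[OF i_inj])
      (simp add: S mu_induced[OF s, of x] mu_induced[OF t, of y] E.prod_commute[of "t y"])
  moreover have "H x y - H' x y = \<rho> x (\<phi> y) - \<phi> (pbrack P x y) - \<rho> y (\<phi> x)" for x y
    using E.brack_skew[of "t y" "s x"] E.brack_skew[of "t y" "t x"]
    by (intro injD[OF i_inj]) (simp add: S rho_induced[OF s, of x] rho_induced[OF t, of y])
  ultimately show ?thesis
    using section_cocycle_in[OF s] section_cocycle_in[OF t]
    unfolding ceq ceq' poisson_cohomologous_def prod.case mem_Collect_eq by blast
qed

theorem wells_map_eq:
  assumes D: "D \<in> compatible_pairs P vs \<mu> \<rho>" and s: "linear_section P E p s"
  shows "wells_map P vs \<mu> \<rho> E i p D =
    H2_class P vs \<mu> \<rho> (derived_cocycle D (section_cocycle P E i s))"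
  unfolding wells_map_def H2_class_def
  by (rule equiv_class_eq[OF equiv_cohomologous derived_cocycle_cong[OF
        section_cocycle_cohomologous[OF someI_ex[OF ex_linear_section] s] D]])

theorem wells_map_in:
  assumes "D \<in> compatible_pairs P vs \<mu> \<rho>"
  shows "wells_map P vs \<mu> \<rho> E i p D \<in> H2_FGV P vs \<mu> \<rho>"
  unfolding wells_map_def H2_class_def H2_FGV_def
  by (rule quotientI[OF derived_cocycle_in[OF section_cocycle_in[OF
        someI_ex[OF ex_linear_section]] assms]])

end

end

theory Submission
  imports Defs
begin

text \<open>Fix a linear section \<open>s\<close> of \<open>p\<close>, so that \<open>E = s(P) \<oplus> i(V)\<close>. A linear map \<open>d\<close> of \<open>E\<close> that
  restricts to \<open>dV\<close> on \<open>V\<close> and induces \<open>dP\<close> on \<open>P\<close> is the same thing as a linear map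
  \<open>\<phi> : P \<rightarrow> V\<close>, via \<open>d (s x + i v) = s (dP x) + i (\<phi> x + dV v)\<close>. Evaluated on \<open>s x\<close> and \<open>i v\<close>,
  the derivation rules for \<open>d\<close> are the compatibility conditions defining \<open>\<D>\<close>; evaluated on \<open>s x\<close>
  and \<open>s y\<close>, they say that the coboundary of \<open>\<phi>\<close> is the cocycle representing the Wells class.\<close>

context abelian_extension
begin

lemma p_i: "p (i v) = 0"
  using exact by blast

lemma i_mult_i: "pprod E (i v) (i w) = 0"
  using i_hom linear_facts(4)[OF i_linear] by (simp add: poisson_hom_def trivial_poisson_def)

lemma i_brack_i: "pbrack E (i v) (i w) = 0"
  using i_hom linear_facts(4)[OF i_linear] by (simp add: poisson_hom_def trivial_poisson_def)

text \<open>Cohomology is an equivalence relation on cocycles, so the class vanishes exactly when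
  its representative is cohomologous to zero. This trades \<open>wells_map\<close> for a potential
  \<phi>, computed with any section at hand.\<close>

lemma wells_map_eq_zero_iff:
  assumes D: "D \<in> compatible_pairs P vs \<mu> \<rho>" and s: "linear_section P E p s"
    and hH: "derived_cocycle D (section_cocycle P E i s) = (h, H)"
  shows "wells_map P vs \<mu> \<rho> E i p D = H2_zero P vs \<mu> \<rho> \<longleftrightarrow>
    (\<exists>\<phi>. Vector_Spaces.linear (pscale P) vs \<phi> \<and>
      (\<forall>x y. h x y = \<mu> x (\<phi> y) - \<phi> (pprod P x y) + \<mu> y (\<phi> x)) \<and>
      (\<forall>x y. H x y = \<rho> x (\<phi> y) - \<phi> (pbrack P x y) - \<rho> y (\<phi> x)))"
proof -
  have hH_in: "(h, H) \<in> poisson_cocycles P vs \<mu> \<rho>"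
    using derived_cocycle_in[OF section_cocycle_in[OF s] D] hH by simp
  have "wells_map P vs \<mu> \<rho> E i p D = H2_zero P vs \<mu> \<rho> \<longleftrightarrow>
      ((h, H), ((\<lambda>_ _. 0), (\<lambda>_ _. 0))) \<in> poisson_cohomologous P vs \<mu> \<rho>"
    unfolding wells_map_eq[OF D s] hH H2_zero_def H2_class_def
    by (rule eq_equiv_class_iff[OF equiv_cohomologous hH_in zero_cocycle])
  then show ?thesis
    using hH_in zero_cocycle by (simp add: poisson_cohomologous_def)
qed

text \<open>The difference \<open>e - s (p e)\<close> lies in the kernel of \<open>p\<close>, which
  is the range of \<open>i\<close>.\<close>

lemma section_decomposition:
  assumes "linear_section P E p s"
  obtains x v where "e = s x + i v"
proof
  have "p (s x) = x" for x
    using assms by (simp add: linear_section_def fun_eq_iff)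
  then show "e = s (p e) + i (inv i (e - s (p e)))"
    by (simp add: i_inv linear_facts[OF p_linear])
qed

lemma inducible_imp:
  assumes dV: "dV \<in> poisson_Der (trivial_poisson vs)" and dP: "dP \<in> poisson_Der P"
    and ind: "inducible P E i p (dV, dP)"
  shows "(dV, dP) \<in> compatible_pairs P vs \<mu> \<rho>"
    and "wells_map P vs \<mu> \<rho> E i p (dV, dP) = H2_zero P vs \<mu> \<rho>"
proof -
  obtain s where s: "linear_section P E p s" using ex_linear_section by blast
  have sl: "Vector_Spaces.linear (pscale P) (pscale E) s"
    using s by (simp add: linear_section_def)
  have ps: "p (s x) = x" for x
    using s by (simp add: linear_section_def fun_eq_iff)
  from ind obtain d where d: "d \<in> poisson_Der E" and di: "\<And>v. d (i v) = i (dV v)"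
    and pds: "p \<circ> d \<circ> s = dP"
    using s by (auto simp: inducible_def)
  have dl: "Vector_Spaces.linear (pscale E) (pscale E) d"
    and dder: "\<And>x y. d (pprod E x y) = pprod E (d x) y + pprod E x (d y)"
      "\<And>x y. d (pbrack E x y) = pbrack E (d x) y + pbrack E x (d y)"
    using d by (auto simp: poisson_Der_def)
  have dPl: "Vector_Spaces.linear (pscale P) (pscale P) dP"
    and dPder: "\<And>x y. dP (pprod P x y) = pprod P (dP x) y + pprod P x (dP y)"
      "\<And>x y. dP (pbrack P x y) = pbrack P (dP x) y + pbrack P x (dP y)"
    using dP by (auto simp: poisson_Der_def)
  \<comment> \<open>The defect of \<open>d\<close> against the section: \<open>p\<close> kills it
    because \<open>p \<circ> d \<circ> s = dP\<close>, so \<open>inv i\<close> is a true preimage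
    here.\<close>
  define \<phi> where "\<phi> x = inv i (d (s x) - s (dP x))" for x
  have "i (\<phi> x) = d (s x) - s (dP x)" for x
    unfolding \<phi>_def using pds
    by (intro i_inv) (auto simp: linear_facts[OF p_linear] ps fun_eq_iff)
  then have ds: "d (s x) = s (dP x) + i (\<phi> x)" for x by simp
  note S = linear_facts[OF i_linear] linear_facts[OF sl] linear_facts[OF dl] linear_facts[OF dPl]
    rep_simps bilinear_facts[OF E.prod_bilinear] bilinear_facts[OF E.brack_bilinear]
    dder dPder di ds i_mult_i i_brack_i
  have comp: "dV (\<mu> x v) = \<mu> (dP x) v + \<mu> x (dV v)"
    "dV (\<rho> x v) = \<rho> (dP x) v + \<rho> x (dV v)" for x v
  proof -
    \<comment> \<open>Expanding the right-hand sides by the derivation rules, the correction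
      \<open>i (\<phi> x)\<close> in \<open>d (s x)\<close> drops out, since it meets only elements
      of V.\<close>
    have "i (dV (\<mu> x v)) = d (pprod E (s x) (i v))" "i (dV (\<rho> x v)) = d (pbrack E (s x) (i v))"
      by (simp_all only: di[symmetric] mu_induced[OF s] rho_induced[OF s])
    then show "dV (\<mu> x v) = \<mu> (dP x) v + \<mu> x (dV v)"
      "dV (\<rho> x v) = \<rho> (dP x) v + \<rho> x (dV v)"
      by (auto intro!: injD[OF i_inj] simp: S mu_induced[OF s] rho_induced[OF s])
  qed
  show D: "(dV, dP) \<in> compatible_pairs P vs \<mu> \<rho>"
    using dV dP comp by (simp add: compatible_pairs_def)
  obtain h H where ceq: "section_cocycle P E i s = (h, H)" by fastforce
  note iC = i_section_cocycle[OF s, unfolded ceq fst_conv snd_conv]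
  have i\<phi>: "i (\<phi> x) = d (s x) - s (dP x)" for x by (simp add: ds)
  have "Vector_Spaces.linear (pscale P) vs \<phi>"
    \<comment> \<open>The slice of \<open>S\<close> keeps only the linearity facts of
      \<open>i\<close>, \<open>s\<close>, \<open>d\<close> and \<open>dP\<close>: rewriting with
      both \<open>ds\<close> and \<open>i\<phi>\<close> would loop.\<close>
    by (rule linearI; (rule injD[OF i_inj])?;
        simp add: P.vector_space_axioms V.vector_space_axioms S(1-20) i\<phi> E.scale_right_diff_distrib)
  moreover have "dV (h x y) - h (dP x) y - h x (dP y)
      = \<mu> x (\<phi> y) - \<phi> (pprod P x y) + \<mu> y (\<phi> x)" for x y
  proof (rule injD[OF i_inj])
    \<comment> \<open>Apply \<open>d\<close> to the equation defining \<open>h\<close>. The parts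
      lying in \<open>s\<close> reassemble into \<open>h (dP x) y + h x (dP y)\<close>, and the
      \<phi> terms form the coboundary.\<close>
    have "i (dV (h x y)) = d (pprod E (s x) (s y)) - d (s (pprod P x y))"
      by (simp only: di[symmetric] iC linear_facts[OF dl])
    then show "i (dV (h x y) - h (dP x) y - h x (dP y))
      = i (\<mu> x (\<phi> y) - \<phi> (pprod P x y) + \<mu> y (\<phi> x))"
      by (simp add: S iC mu_induced[OF s] E.prod_commute[of "i _"])
  qed
  moreover have "dV (H x y) - H (dP x) y - H x (dP y)
      = \<rho> x (\<phi> y) - \<phi> (pbrack P x y) - \<rho> y (\<phi> x)" for x y
  proof (rule injD[OF i_inj])
    have "i (dV (H x y)) = d (pbrack E (s x) (s y)) - d (s (pbrack P x y))"
      by (simp only: di[symmetric] iC linear_facts[OF dl])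
    then show "i (dV (H x y) - H (dP x) y - H x (dP y))
      = i (\<rho> x (\<phi> y) - \<phi> (pbrack P x y) - \<rho> y (\<phi> x))"
      \<comment> \<open>Moving \<open>s y\<close> to the left of \<open>i (\<phi> x)\<close>
        produces the minus sign of the last coboundary term.\<close>
      using E.brack_skew[of "i (\<phi> x)" "s y"] by (simp add: S iC rho_induced[OF s])
  qed
  ultimately show "wells_map P vs \<mu> \<rho> E i p (dV, dP) = H2_zero P vs \<mu> \<rho>"
    by (subst wells_map_eq_zero_iff[OF D s]) (auto simp: ceq derived_cocycle_def)
qed

lemma inducibleI:
  assumes D: "(dV, dP) \<in> compatible_pairs P vs \<mu> \<rho>"
    and W: "wells_map P vs \<mu> \<rho> E i p (dV, dP) = H2_zero P vs \<mu> \<rho>"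
  shows "inducible P E i p (dV, dP)"
proof -
  obtain s where s: "linear_section P E p s" using ex_linear_section by blast
  have sl: "Vector_Spaces.linear (pscale P) (pscale E) s"
    using s by (simp add: linear_section_def)
  have ps: "p (s x) = x" for x
    using s by (simp add: linear_section_def fun_eq_iff)
  have dV: "Vector_Spaces.linear vs vs dV"
    and dPl: "Vector_Spaces.linear (pscale P) (pscale P) dP"
    and dPder: "\<And>x y. dP (pprod P x y) = pprod P (dP x) y + pprod P x (dP y)"
      "\<And>x y. dP (pbrack P x y) = pbrack P (dP x) y + pbrack P x (dP y)"
    and comp: "\<And>x v. dV (\<mu> x v) = \<mu> (dP x) v + \<mu> x (dV v)"
      "\<And>x v. dV (\<rho> x v) = \<rho> (dP x) v + \<rho> x (dV v)"
    using D by (auto simp: compatible_pairs_def poisson_Der_def trivial_poisson_def)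
  obtain h H where ceq: "section_cocycle P E i s = (h, H)" by fastforce
  note iC = i_section_cocycle[OF s, unfolded ceq fst_conv snd_conv]
  from W obtain \<phi> where \<phi>: "Vector_Spaces.linear (pscale P) vs \<phi>"
    and h: "\<And>x y. dV (h x y) - h (dP x) y - h x (dP y)
        = \<mu> x (\<phi> y) - \<phi> (pprod P x y) + \<mu> y (\<phi> x)"
    and H: "\<And>x y. dV (H x y) - H (dP x) y - H x (dP y)
        = \<rho> x (\<phi> y) - \<phi> (pbrack P x y) - \<rho> y (\<phi> x)"
    unfolding wells_map_eq_zero_iff[OF D s, unfolded ceq derived_cocycle_def prod.case, OF refl]
    by blast
  \<comment> \<open>Solved for \<open>dV\<close>, the two equations serve as rewrite rules
    below.\<close>
  have h': "dV (h x y) = h (dP x) y + h x (dP y) + \<mu> x (\<phi> y) - \<phi> (pprod P x y) + \<mu> y (\<phi> x)"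
    for x y using h[of x y] by (simp add: algebra_simps)
  have H': "dV (H x y) = H (dP x) y + H x (dP y) + \<rho> x (\<phi> y) - \<phi> (pbrack P x y) - \<rho> y (\<phi> x)"
    for x y using H[of x y] by (simp add: algebra_simps)
  \<comment> \<open>In the coordinates given by \<open>s\<close>, E is the semidirect product of P
    and V twisted by the cocycle \<open>(h, H)\<close>.\<close>
  have prod_eq: "pprod E (s x + i v) (s y + i w)
      = s (pprod P x y) + i (h x y + \<mu> x w + \<mu> y v)" for x y v w
    using E.prod_commute[of "i v" "s y"]
    by (simp add: bilinear_facts[OF E.prod_bilinear] linear_facts[OF i_linear] iC
        mu_induced[OF s] i_mult_i)
  have brack_eq: "pbrack E (s x + i v) (s y + i w)
      = s (pbrack P x y) + i (H x y + \<rho> x w - \<rho> y v)" for x y v w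
    using E.brack_skew[of "i v" "s y"]
    by (simp add: bilinear_facts[OF E.brack_bilinear] linear_facts[OF i_linear] iC
        rho_induced[OF s] i_brack_i)
  \<comment> \<open>The coordinates of \<open>e\<close> are \<open>p e\<close> and
    \<open>inv i (e - s (p e))\<close>.\<close>
  define d where "d e = s (dP (p e)) + i (\<phi> (p e) + dV (inv i (e - s (p e))))" for e
  have d_eq: "d (s x + i v) = s (dP x) + i (\<phi> x + dV v)" for x v
    by (simp add: d_def linear_facts[OF p_linear] ps p_i inv_f_f[OF i_inj])
  note S = linear_facts[OF i_linear] linear_facts[OF sl] linear_facts[OF dV] linear_facts[OF dPl]
    linear_facts[OF \<phi>] rep_simps
  have d_prod: "d (pprod E a b) = pprod E (d a) b + pprod E a (d b)" for a b
  proof -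
    obtain x v where a: "a = s x + i v" by (rule section_decomposition[OF s])
    obtain y w where b: "b = s y + i w" by (rule section_decomposition[OF s])
    show ?thesis
      \<comment> \<open>The P-components agree by \<open>dPder\<close>. In V, \<open>comp\<close>
        handles the action terms, and \<open>h'\<close> supplies a
        \<open>\<phi> (pprod P x y)\<close> that cancels the one from \<open>d_eq\<close>.\<close>
      unfolding a b prod_eq d_eq by (simp add: S dPder comp h' algebra_simps)
  qed
  have d_brack: "d (pbrack E a b) = pbrack E (d a) b + pbrack E a (d b)" for a b
  proof -
    obtain x v where a: "a = s x + i v" by (rule section_decomposition[OF s])
    obtain y w where b: "b = s y + i w" by (rule section_decomposition[OF s])
    show ?thesis
      unfolding a b brack_eq d_eq by (simp add: S dPder comp H' algebra_simps)
  qed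
  have "d (a + b) = d a + d b" for a b
  proof -
    obtain x v where a: "a = s x + i v" by (rule section_decomposition[OF s])
    obtain y w where b: "b = s y + i w" by (rule section_decomposition[OF s])
    have "a + b = s (x + y) + i (v + w)" by (simp add: a b S)
    then show ?thesis by (simp only: d_eq) (simp add: a b d_eq S)
  qed
  moreover have "d (pscale E c a) = pscale E c (d a)" for c a
  proof -
    obtain x v where a: "a = s x + i v" by (rule section_decomposition[OF s])
    have "pscale E c a = s (pscale P c x) + i (vs c v)"
      by (simp add: a S E.scale_right_distrib)
    then show ?thesis by (simp only: d_eq) (simp add: a d_eq S E.scale_right_distrib)
  qed
  ultimately have "Vector_Spaces.linear (pscale E) (pscale E) d"
    by (intro linearI E.vector_space_axioms)
  then have "d \<in> poisson_Der E"
    using d_prod d_brack by (simp add: poisson_Der_def)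
  moreover have di: "d (i v) = i (dV v)" for v
    using d_eq[of 0 v] by (simp add: S)
  \<comment> \<open>By construction \<open>p (d e) = dP (p e)\<close> for every \<open>e\<close>, so
    any section \<open>t\<close> will do, not only the \<open>s\<close> used to build
    \<open>d\<close>.\<close>
  moreover have "p \<circ> d \<circ> t = dP" if "linear_section P E p t" for t
    using that by (auto simp: d_def linear_section_def fun_eq_iff linear_facts[OF p_linear] ps p_i)
  ultimately show ?thesis
    by (auto simp: inducible_def intro!: bexI[of _ d])
qed

end

theorem theorem4p3:
  fixes P :: "('k::field_char_0, 'p::ab_group_add) poisson"
    and vs :: "'k \<Rightarrow> 'v::ab_group_add \<Rightarrow> 'v"
    and \<mu> \<rho> :: "'p \<Rightarrow> 'v \<Rightarrow> 'v"
    and E :: "('k, 'e::ab_group_add) poisson"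
    and i :: "'v \<Rightarrow> 'e" and p :: "'e \<Rightarrow> 'p"
    and dV :: "'v \<Rightarrow> 'v" and dP :: "'p \<Rightarrow> 'p"
  assumes "poisson_algebra P"
    and "poisson_representation P vs \<mu> \<rho>"
    and "abelian_extension P vs \<mu> \<rho> E i p"
    and "dV \<in> poisson_Der (trivial_poisson vs)"
    and "dP \<in> poisson_Der P"
  shows "inducible P E i p (dV, dP) \<longleftrightarrow>
    (dV, dP) \<in> compatible_pairs P vs \<mu> \<rho> \<and>
    wells_map P vs \<mu> \<rho> E i p (dV, dP) = H2_zero P vs \<mu> \<rho>"
proof -
  interpret abelian_extension P vs \<mu> \<rho> E i p by fact
  show ?thesis
    using inducible_imp[OF assms(4,5)] inducibleI by blast
qed

end
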